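(* Let $F$ be a field and let $A$ be a unital (associative) $F$-algebra with a surjective inner derivation, i.e. there exists $v\in A$ such that for every $y\in A$ there is an $x\in A$ with $[v,x]=y$. Then every nonzero multilinear polynomial is surjective on $A$; that is, for every $n\in\mathbb N$ and every nonzero multilinear noncommutative polynomial $f\in F\langle X_1,\dots,X_n\rangle$, one has $f(A)=A$.
   Context: $\mathbb N=\{1,2,\dots\}$. $F\langle X_1,\dots,X_n\rangle$ is the free (associative unital) algebra over the field $F$; its elements are called noncommutative polynomials. A polynomial $f\in F\langle X_1,\dots,X_n\rangle$ is multilinear if $f=\sum_{\sigma\in S_n}\lambda_\sigma X_{\sigma(1)}\cdots X_{\sigma(n)}$ for some $\lambda_\sigma\in F$. The image of $f$ on an $F$-algebra $A$ is $f(A)=\{f(a_1,\dots,a_n)\mid a_1,\dots,a_n\in A\}$, and $f$ is surjective on $A$ if $f(A)=A$. Here $[v,x]=vx-xv$; an inner derivation of $A$ is a map $x\mapsto[v,x]$ with $v\in A$ fixed. *)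

theory Defs
  imports Complex_Main "HOL-Library.Poly_Mapping" "HOL-Combinatorics.Permutations"
begin

text \<open>
  Words over an alphabet, written additively (addition is concatenation) because the
  convolution product of \<^theory>\<open>HOL-Library.Poly_Mapping\<close> expects an additive monoid
  of exponents.  A separate type is used so that lists themselves stay uninstantiated.
\<close>

datatype 'a free_monoid = Word (letters: "'a list")

instantiation free_monoid :: (type) monoid_add
begin

definition zero_free_monoid :: "'a free_monoid"
  where "0 = Word []"

definition plus_free_monoid :: "'a free_monoid \<Rightarrow> 'a free_monoid \<Rightarrow> 'a free_monoid"
  where "u + w = Word (letters u @ letters w)"

instance
  by standard (simp_all add: zero_free_monoid_def plus_free_monoid_def)

end

lemma letters_zero [simp]: "letters 0 = []"
  by (simp add: zero_free_monoid_def)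

lemma letters_plus [simp]: "letters (u + w) = letters u @ letters w"
  by (simp add: plus_free_monoid_def)

text \<open>
  This type is the free algebra on the countably many variables $X_0, X_1, X_2, \dots$, with
  the ring structure provided by the library (the monoid algebra of the free monoid).
  The free algebra on $X_1, \dots, X_n$ is the subalgebra \<open>free_algebra n\<close> below.
\<close>

type_synonym 'f nc_poly = "nat free_monoid \<Rightarrow>\<^sub>0 'f"

definition nc_const :: "'f::field \<Rightarrow> 'f nc_poly"
  where "nc_const c = Poly_Mapping.single 0 c"

definition nc_var :: "nat \<Rightarrow> 'f::field nc_poly"
  where "nc_var i = Poly_Mapping.single (Word [i]) 1"

definition free_algebra :: "nat \<Rightarrow> 'f::field nc_poly set"
  where "free_algebra n = {f. \<forall>w\<in>Poly_Mapping.keys f. set (letters w) \<subseteq> {1..n}}"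

definition multilinear :: "nat \<Rightarrow> 'f::field nc_poly \<Rightarrow> bool"
  where "multilinear n f \<longleftrightarrow>
    (\<exists>c. f = (\<Sum>\<sigma> | \<sigma> permutes {1..n}.
            nc_const (c \<sigma>) * prod_list (map (\<lambda>i. nc_var (\<sigma> i)) [1..<Suc n])))"

text \<open>
  The sort \<open>{ring, monoid_mult}\<close> is used instead of \<^class>\<open>ring_1\<close> because the latter
  excludes the zero algebra.
\<close>

locale unital_algebra = vector_space scale
  for scale :: "'f::field \<Rightarrow> 'a::{ring, monoid_mult} \<Rightarrow> 'a" +
  assumes scale_mult_left: "scale c x * y = scale c (x * y)"
    and scale_mult_right: "x * scale c y = scale c (x * y)"

definition nc_eval ::
  "('f::field \<Rightarrow> 'a::{ring, monoid_mult} \<Rightarrow> 'a) \<Rightarrow> 'f nc_poly \<Rightarrow> (nat \<Rightarrow> 'a) \<Rightarrow> 'a"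
  where "nc_eval scale f a =
    (\<Sum>w\<in>Poly_Mapping.keys f. scale (Poly_Mapping.lookup f w) (prod_list (map a (letters w))))"

text \<open>
  The tuple of arguments is given as a sequence; for \<open>f \<in> free_algebra n\<close> only its entries
  with index in \<open>{1..n}\<close> matter, see \<open>nc_eval_cong\<close>.
\<close>

definition nc_image ::
  "('f::field \<Rightarrow> 'a::{ring, monoid_mult} \<Rightarrow> 'a) \<Rightarrow> 'f nc_poly \<Rightarrow> 'a set"
  where "nc_image scale f = {nc_eval scale f a | a. True}"

definition commutator :: "'a::ring \<Rightarrow> 'a \<Rightarrow> 'a"
  where "commutator v x = v * x - x * v"

definition inner_derivation :: "('a::ring \<Rightarrow> 'a) \<Rightarrow> bool"
  where "inner_derivation d \<longleftrightarrow> (\<exists>v. \<forall>x. d x = commutator v x)"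

lemma nc_eval_cong:
  assumes "f \<in> free_algebra n" and "\<And>i. i \<in> {1..n} \<Longrightarrow> a i = b i"
  shows "nc_eval scale f a = nc_eval scale f b"
  unfolding nc_eval_def
proof (rule sum.cong)
  fix w assume "w \<in> Poly_Mapping.keys f"
  then have "set (letters w) \<subseteq> {1..n}"
    using assms(1) by (auto simp: free_algebra_def)
  then have "map a (letters w) = map b (letters w)"
    using assms(2) by (intro map_cong) auto
  then show "scale (Poly_Mapping.lookup f w) (prod_list (map a (letters w))) =
      scale (Poly_Mapping.lookup f w) (prod_list (map b (letters w)))"
    by (rule arg_cong)
qed simp

text \<open>
  For an algebra, \<open>\<lambda>f. nc_eval scale f a\<close> is the unital algebra homomorphism sending
  each variable $X_i$ to \<open>a i\<close>.
\<close>

context unital_algebra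
begin

lemma nc_eval_single:
  "nc_eval scale (Poly_Mapping.single w c) a = scale c (prod_list (map a (letters w)))"
  by (simp add: nc_eval_def)

lemma nc_eval_const: "nc_eval scale (nc_const c) a = scale c 1"
  by (simp add: nc_const_def nc_eval_single)

lemma nc_eval_var: "nc_eval scale (nc_var i) a = a i"
  by (simp add: nc_var_def nc_eval_single)

lemma nc_eval_add: "nc_eval scale (f + g) a = nc_eval scale f a + nc_eval scale g a"
  unfolding nc_eval_def
  by (rule setsum_keys_plus_distrib) (simp_all add: scale_left_distrib)

lemma nc_eval_zero: "nc_eval scale 0 a = 0"
  by (simp add: nc_eval_def)

lemma nc_eval_mult: "nc_eval scale (f * g) a = nc_eval scale f a * nc_eval scale g a"
proof -
  have dec: "Poly_Mapping.update k b q = q + Poly_Mapping.single k b"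
    if "k \<notin> Poly_Mapping.keys q" for q :: "'f nc_poly" and k b
    using that
    by (intro poly_mapping_eqI)
      (auto simp: update.rep_eq lookup_add lookup_single when_def in_keys_iff)
  have single: "nc_eval scale (Poly_Mapping.single w c * g) a =
      nc_eval scale (Poly_Mapping.single w c) a * nc_eval scale g a" for w c
  proof (induction g rule: update_induct)
    case const
    then show ?case by (simp add: nc_eval_zero)
  next
    case (update q k b)
    have "Poly_Mapping.update k b q = q + Poly_Mapping.single k b"
      using update.hyps by (intro dec)
    then show ?case
      using update.IH
      by (simp add: distrib_left nc_eval_add mult_single nc_eval_single
          scale_mult_left scale_mult_right)
  qed
  show ?thesis
  proof (induction f rule: update_induct)
    case const
    then show ?case by (simp add: nc_eval_zero)
  next
    case (update q k b)
    have "Poly_Mapping.update k b q = q + Poly_Mapping.single k b"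
      using update.hyps by (intro dec)
    then show ?case
      using update.IH by (simp add: distrib_right nc_eval_add single)
  qed
qed

end

end

theory Submission
  imports Defs "HOL-Combinatorics.Multiset_Permutations" "HOL-Computational_Algebra.Polynomial"
begin

text \<open>
  Let \<open>D = [v, -]\<close>. We enlarge the class of multilinear polynomials to sums, over all orderings
  \<open>\<tau>\<close> of a finite set of variables, of products of the \<open>D\<^sup>e\<^sup>i x\<^sub>i\<close> in the order \<open>\<tau>\<close>; the coefficients
  for a given \<open>\<tau>\<close> form a commutative polynomial \<open>P \<tau>\<close> whose exponents are the orders of
  differentiation \<open>e\<^sub>i\<close>. If all \<open>P \<tau>\<close> are homogeneous of the same degree and not all vanish, such
  an expression is surjective. A single variable gives \<open>c D\<^sup>d x\<close> with \<open>c \<noteq> 0\<close>.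
  Otherwise choose a variable \<open>x\<^sub>a\<close>, let \<open>m\<close> be its least exponent, and substitute \<open>x\<^sub>a = z\<close> with
  \<open>D\<^sup>m z = v\<^sup>k\<close>: since \<open>D v\<^sup>k = 0\<close>, only terms with exponent exactly \<open>m\<close> survive. Moving \<open>v\<^sup>k\<close> to the
  far left across a prefix \<open>u\<close> acts on coefficients as \<open>(v + s\<^sub>u)\<^sup>k\<close>, where \<open>s\<^sub>u\<close> is minus the sum of
  the variables in \<open>u\<close>. Distinct prefixes of one ordering have distinct \<open>s\<^sub>u\<close>, so by a Vandermonde
  argument the sums of \<open>s\<^sub>u\<^sup>k P\<close> cannot vanish for all \<open>k\<close>; for the least \<open>k\<close> where they do not,
  all powers of \<open>v\<close> disappear and one variable has been eliminated.
\<close>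

section \<open>Vandermonde independence over an integral domain\<close>

lemma vandermonde_independent:
  fixes s p :: "'b \<Rightarrow> 'r::idom"
  assumes "finite S" and "inj_on s S" and "j \<in> S"
    and zero: "\<And>k. (\<Sum>i\<in>S. s i ^ k * p i) = 0"
  shows "p j = 0"
proof -
  have all: "(\<Sum>i\<in>S. poly q (s i) * p i) = 0" for q
  proof -
    have "(\<Sum>i\<in>S. poly q (s i) * p i)
        = (\<Sum>i\<in>S. \<Sum>k\<le>degree q. coeff q k * (s i ^ k * p i))"
      by (simp add: poly_altdef sum_distrib_right mult.assoc)
    also have "\<dots> = (\<Sum>k\<le>degree q. coeff q k * (\<Sum>i\<in>S. s i ^ k * p i))"
      by (subst sum.swap) (simp add: sum_distrib_left)
    finally show ?thesis by (simp add: zero)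
  qed
  \<comment> \<open>As \<open>all\<close> holds for every polynomial, take one that vanishes at all
    nodes except \<open>s j\<close>.\<close>
  define q where "q = (\<Prod>i\<in>S - {j}. [:- s i, 1:])"
  have q_zero: "poly q (s i) = 0" if "i \<in> S - {j}" for i
    using that assms(1) by (auto simp: q_def poly_prod)
  have "(\<Sum>i\<in>S. poly q (s i) * p i) = poly q (s j) * p j"
    using assms(1,3) q_zero by (subst sum.remove[of S j]) auto
  moreover have "poly q (s j) \<noteq> 0"
    using assms(1-3) by (auto simp: q_def poly_prod inj_on_def)
  ultimately show ?thesis using all[of q] by simp
qed

section \<open>Derivation rules for the commutator\<close>

lemma commutator_Leibniz:
  "commutator v (x * y) = commutator v x * y + x * commutator v (y :: 'a::ring)"
  by (simp add: commutator_def algebra_simps)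

lemma commutator_zero [simp]: "commutator v (0 :: 'a::ring) = 0"
  by (simp add: commutator_def)

lemma commutator_one [simp]: "commutator v (1 :: 'a::{ring, monoid_mult}) = 0"
  by (simp add: commutator_def)

lemma commutator_power_self [simp]: "commutator v (v ^ k :: 'a::{ring, monoid_mult}) = 0"
  by (simp add: commutator_def power_commutes)

lemma funpow_commutator_zero [simp]: "(commutator v ^^ k) (0 :: 'a::ring) = 0"
  by (induction k) auto

section \<open>Commutative coefficient polynomials and their degrees\<close>

type_synonym 'f cpoly = "(nat \<Rightarrow>\<^sub>0 nat) \<Rightarrow>\<^sub>0 'f"

text \<open>Multiplying a coefficient by the variable of index \<open>i\<close> stands for
  differentiating \<open>x i\<close> once more. The sign comes from
  \<open>p * v = v * p - commutator v p\<close>.\<close>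

definition slope :: "nat list \<Rightarrow> 'f::field cpoly"
  where "slope u = - (\<Sum>i\<in>set u. Poly_Mapping.single (Poly_Mapping.single i 1) 1)"

lemma lookup_slope:
  "Poly_Mapping.lookup (slope u :: 'f::field cpoly) (Poly_Mapping.single i 1) =
    (if i \<in> set u then - 1 else 0)"
proof -
  have "Poly_Mapping.single j (1::nat) = Poly_Mapping.single i 1 \<longleftrightarrow> j = i" for j :: nat
    by (metis lookup_single_eq lookup_single_not_eq zero_neq_one)
  then show ?thesis
    by (simp add: slope_def lookup_sum lookup_single when_def if_distrib[of uminus])
qed

text \<open>The linear coefficients recover the set, because \<open>- 1\<close> differs from
  \<open>0\<close> in every characteristic.\<close>

lemma slope_eq_imp_set_eq:
  assumes "(slope u :: 'f::field cpoly) = slope u'"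
  shows "set u = set u'"
proof -
  have "i \<in> set u \<longleftrightarrow> i \<in> set u'" for i
    using lookup_slope[of u i, where ?'f = 'f] lookup_slope[of u' i, where ?'f = 'f] assms
    by (auto split: if_splits)
  then show ?thesis by blast
qed

text \<open>
  The prescribed exponents \<open>g\<close> outside \<open>V\<close> record variables that have already been
  eliminated; keeping them avoids dividing by powers of these variables.
\<close>

definition homogeneous :: "nat set \<Rightarrow> (nat \<Rightarrow> nat) \<Rightarrow> nat \<Rightarrow> 'f::field cpoly \<Rightarrow> bool"
  where "homogeneous V g d P \<longleftrightarrow> (\<forall>\<alpha>\<in>Poly_Mapping.keys P.
    (\<forall>i. i \<notin> V \<longrightarrow> Poly_Mapping.lookup \<alpha> i = g i) \<and> (\<Sum>i\<in>V. Poly_Mapping.lookup \<alpha> i) = d)"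

lemma homogeneous_sum:
  assumes "\<And>j. j \<in> J \<Longrightarrow> homogeneous V g d (P j)"
  shows "homogeneous V g d (sum P J)"
  using assms keys_sum[of P J] unfolding homogeneous_def by fast

lemma homogeneous_slope_mult:
  assumes "finite V" and "set u \<subseteq> V" and P: "homogeneous V g d P"
  shows "homogeneous V g (Suc d) (slope u * P)"
  unfolding homogeneous_def
proof
  fix \<alpha> assume "\<alpha> \<in> Poly_Mapping.keys (slope u * P)"
  then obtain \<beta> \<gamma> where \<alpha>: "\<alpha> = \<beta> + \<gamma>" and \<beta>: "\<beta> \<in> Poly_Mapping.keys (slope u :: 'a cpoly)"
    and \<gamma>: "\<gamma> \<in> Poly_Mapping.keys P"
    using keys_mult[of "slope u" P] by blast
  have "\<beta> \<in> (\<Union>i\<in>set u. Poly_Mapping.keys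
      (Poly_Mapping.single (Poly_Mapping.single i 1) 1 :: 'a cpoly))"
    using \<beta> keys_sum unfolding slope_def keys_minus by fast
  then obtain i where "i \<in> set u" and i: "\<beta> = Poly_Mapping.single i 1"
    by auto
  then show "(\<forall>i. i \<notin> V \<longrightarrow> Poly_Mapping.lookup \<alpha> i = g i) \<and>
      (\<Sum>i\<in>V. Poly_Mapping.lookup \<alpha> i) = Suc d"
    using P \<gamma> assms(1,2)
    by (auto simp: homogeneous_def \<alpha> i lookup_add lookup_single when_def sum.distrib)
qed

lemma homogeneous_slope_power_mult:
  assumes "finite V" and "set u \<subseteq> V" and "homogeneous V g d P"
  shows "homogeneous V g (d + k) (slope u ^ k * P)"
proof (induction k)
  case (Suc k)
  then show ?case
    using homogeneous_slope_mult[OF assms(1,2)] by (simp add: mult.assoc)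
qed (simp add: assms(3))

section \<open>Linear extension from exponents to coefficient polynomials\<close>

context unital_algebra
begin

definition lin :: "('k \<Rightarrow> 'a) \<Rightarrow> ('k \<Rightarrow>\<^sub>0 'f) \<Rightarrow> 'a"
  where "lin \<phi> P = (\<Sum>\<alpha>\<in>Poly_Mapping.keys P. scale (Poly_Mapping.lookup P \<alpha>) (\<phi> \<alpha>))"

lemma lin_superset:
  assumes "finite S" and "Poly_Mapping.keys P \<subseteq> S"
  shows "lin \<phi> P = (\<Sum>\<alpha>\<in>S. scale (Poly_Mapping.lookup P \<alpha>) (\<phi> \<alpha>))"
  unfolding lin_def
  by (rule sum.mono_neutral_left) (use assms in \<open>auto simp: in_keys_iff\<close>)

lemma lin_zero [simp]: "lin \<phi> 0 = 0"
  by (simp add: lin_def)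

lemma lin_single [simp]: "lin \<phi> (Poly_Mapping.single \<alpha> c) = scale c (\<phi> \<alpha>)"
  by (simp add: lin_def)

lemma lin_add: "lin \<phi> (P + Q) = lin \<phi> P + lin \<phi> Q"
  unfolding lin_def by (rule setsum_keys_plus_distrib) (simp_all add: scale_left_distrib)

lemma lin_uminus: "lin \<phi> (- P) = - lin \<phi> P"
  by (simp add: lin_def sum_negf)

lemma lin_sum: "lin \<phi> (sum P J) = (\<Sum>j\<in>J. lin \<phi> (P j))"
  by (induction J rule: infinite_finite_induct) (simp_all add: lin_add)

lemma lin_fun_add: "lin (\<lambda>\<alpha>. \<phi> \<alpha> + \<psi> \<alpha>) P = lin \<phi> P + lin \<psi> P"
  by (simp add: lin_def scale_right_distrib sum.distrib)

lemma lin_fun_uminus: "lin (\<lambda>\<alpha>. - \<phi> \<alpha>) P = - lin \<phi> P"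
  by (simp add: lin_def sum_negf)

lemma lin_fun_sum: "lin (\<lambda>\<alpha>. \<Sum>j\<in>J. \<phi> j \<alpha>) P = (\<Sum>j\<in>J. lin (\<phi> j) P)"
  unfolding lin_def scale_sum_right by (rule sum.swap)

lemma lin_fun_mult_left: "lin (\<lambda>\<alpha>. x * \<phi> \<alpha>) P = x * lin \<phi> P"
  by (simp add: lin_def sum_distrib_left scale_mult_right)

lemma lin_single_mult:
  "lin \<phi> (Poly_Mapping.single \<beta> c * P) = scale c (lin (\<lambda>\<alpha>. \<phi> (\<beta> + \<alpha>)) P)"
proof (induction P rule: update_induct)
  case (update p \<alpha> b)
  have "Poly_Mapping.update \<alpha> b p = p + Poly_Mapping.single \<alpha> b"
    using update.hyps
    by (intro poly_mapping_eqI)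
      (auto simp: update.rep_eq lookup_add lookup_single when_def in_keys_iff)
  then show ?case
    using update.IH by (simp add: distrib_left lin_add mult_single scale_right_distrib)
qed simp

lemma lin_slope_mult:
  "lin \<phi> (slope u * P) = - (\<Sum>i\<in>set u. lin (\<lambda>\<alpha>. \<phi> (Poly_Mapping.single i 1 + \<alpha>)) P)"
  by (simp add: slope_def sum_distrib_right lin_uminus lin_sum lin_single_mult)

end

section \<open>Differential monomials and moving powers of \<open>v\<close>\<close>

locale surjective_commutator = unital_algebra scale
  for scale :: "'f::field \<Rightarrow> 'a::{ring, monoid_mult} \<Rightarrow> 'a" +
  fixes v :: 'a
  assumes surj_commutator: "surj (commutator v)"
begin

text \<open>The order of the factors is kept apart from the orders of differentiation, so that for
  fixed \<open>\<tau>\<close> the coefficients lie in a commutative domain, where the Vandermonde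
  argument applies.\<close>

definition dmon :: "(nat \<Rightarrow> 'a) \<Rightarrow> nat list \<Rightarrow> (nat \<Rightarrow>\<^sub>0 nat) \<Rightarrow> 'a"
  where "dmon x \<tau> \<alpha> = prod_list (map (\<lambda>i. (commutator v ^^ Poly_Mapping.lookup \<alpha> i) (x i)) \<tau>)"

lemma dmon_Nil [simp]: "dmon x [] \<alpha> = 1"
  and dmon_Cons [simp]:
    "dmon x (i # \<tau>) \<alpha> = (commutator v ^^ Poly_Mapping.lookup \<alpha> i) (x i) * dmon x \<tau> \<alpha>"
  and dmon_append [simp]: "dmon x (u @ w) \<alpha> = dmon x u \<alpha> * dmon x w \<alpha>"
  by (simp_all add: dmon_def)

lemma dmon_upd [simp]: "a \<notin> set \<tau> \<Longrightarrow> dmon (x(a := z)) \<tau> \<alpha> = dmon x \<tau> \<alpha>"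
  by (induction \<tau>) auto

lemma dmon_single_add:
  "i \<notin> set \<tau> \<Longrightarrow> dmon x \<tau> (Poly_Mapping.single i k + \<alpha>) = dmon x \<tau> \<alpha>"
  by (induction \<tau>) (auto simp: lookup_add lookup_single when_def)

text \<open>This is the Leibniz rule. As \<open>\<tau>\<close> is distinct, raising the exponent at
  \<open>i\<close> differentiates exactly one factor.\<close>

lemma commutator_dmon:
  assumes "distinct \<tau>"
  shows "commutator v (dmon x \<tau> \<alpha>) = (\<Sum>i\<in>set \<tau>. dmon x \<tau> (Poly_Mapping.single i 1 + \<alpha>))"
  using assms
proof (induction \<tau>)
  case (Cons j \<tau>)
  let ?e = "\<lambda>i. Poly_Mapping.single i (1::nat) + \<alpha>"
  have eq: "dmon x (j # \<tau>) (?e i)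
      = (commutator v ^^ Poly_Mapping.lookup \<alpha> j) (x j) * dmon x \<tau> (?e i)"
    if "i \<in> set \<tau>" for i
    using that Cons.prems by (auto simp: lookup_add lookup_single when_def)
  have "commutator v (dmon x (j # \<tau>) \<alpha>) = dmon x (j # \<tau>) (?e j)
      + (commutator v ^^ Poly_Mapping.lookup \<alpha> j) (x j) * (\<Sum>i\<in>set \<tau>. dmon x \<tau> (?e i))"
    using Cons by (simp add: commutator_Leibniz lookup_add dmon_single_add)
  also have "\<dots> = (\<Sum>i\<in>set (j # \<tau>). dmon x (j # \<tau>) (?e i))"
    using Cons.prems eq by (simp add: sum_distrib_left)
  finally show ?case .
qed simp

text \<open>This is what remains of an ordering \<open>u @ a # w\<close> once the factor of the
  variable \<open>a\<close> has become \<open>v ^ k\<close>.\<close>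

definition dmon_ins :: "(nat \<Rightarrow> 'a) \<Rightarrow> nat \<Rightarrow> nat list \<Rightarrow> nat list \<Rightarrow> 'f cpoly \<Rightarrow> 'a"
  where "dmon_ins x k u w P = lin (\<lambda>\<alpha>. dmon x u \<alpha> * v ^ k * dmon x w \<alpha>) P"

text \<open>
  Moving one factor \<open>v\<close> to the far left across \<open>u\<close> costs a derivative of the part in
  front of it, and differentiating that part is multiplication by \<open>- slope u\<close>.
\<close>

lemma dmon_ins_Suc:
  assumes "distinct (u @ w)"
  shows "dmon_ins x (Suc k) u w P = v * dmon_ins x k u w P + dmon_ins x k u w (slope u * P)"
proof -
  let ?e = "\<lambda>i \<alpha>. Poly_Mapping.single i (1::nat) + \<alpha>"
  have "dmon x u \<alpha> * v ^ Suc k * dmon x w \<alpha> = v * (dmon x u \<alpha> * v ^ k * dmon x w \<alpha>)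
      + - (\<Sum>i\<in>set u. dmon x u (?e i \<alpha>) * v ^ k * dmon x w (?e i \<alpha>))" for \<alpha>
  proof -
    have "(\<Sum>i\<in>set u. dmon x u (?e i \<alpha>) * v ^ k * dmon x w (?e i \<alpha>))
        = (\<Sum>i\<in>set u. dmon x u (?e i \<alpha>)) * v ^ k * dmon x w \<alpha>"
      unfolding sum_distrib_right
      by (rule sum.cong) (use assms in \<open>auto simp: dmon_single_add disjoint_iff\<close>)
    also have "\<dots> = commutator v (dmon x u \<alpha>) * v ^ k * dmon x w \<alpha>"
      using assms by (simp add: commutator_dmon)
    finally show ?thesis by (simp add: commutator_def algebra_simps)
  qed
  then show ?thesis
    by (simp only: dmon_ins_def lin_fun_add lin_fun_mult_left lin_fun_uminus lin_fun_sum
        lin_slope_mult)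
qed

text \<open>In the binomial expansion of \<open>(v + slope (u j)) ^ k\<close>, every term with a
  power of \<open>v\<close> on the left carries a sum with some \<open>i < k\<close>, which
  vanishes. The induction varies \<open>P\<close> because one step replaces \<open>P j\<close> by
  \<open>slope (u j) * P j\<close>.\<close>

lemma sum_dmon_ins:
  assumes "\<And>j. j \<in> J \<Longrightarrow> distinct (u j @ w j)"
    and "\<And>i. i < k \<Longrightarrow> (\<Sum>j\<in>J. dmon_ins x 0 (u j) (w j) (slope (u j) ^ i * P j)) = 0"
  shows "(\<Sum>j\<in>J. dmon_ins x k (u j) (w j) (P j))
    = (\<Sum>j\<in>J. dmon_ins x 0 (u j) (w j) (slope (u j) ^ k * P j))"
  using assms(2)
proof (induction k arbitrary: P)
  case (Suc k)
  have "(\<Sum>j\<in>J. dmon_ins x k (u j) (w j) (P j)) = 0"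
    using Suc.IH[of P] Suc.prems by simp
  moreover have "(\<Sum>j\<in>J. dmon_ins x k (u j) (w j) (slope (u j) * P j))
      = (\<Sum>j\<in>J. dmon_ins x 0 (u j) (w j) (slope (u j) ^ k * (slope (u j) * P j)))"
  proof (rule Suc.IH)
    fix i assume "i < k"
    then show "(\<Sum>j\<in>J. dmon_ins x 0 (u j) (w j) (slope (u j) ^ i * (slope (u j) * P j))) = 0"
      using Suc.prems[of "Suc i"] by (simp add: mult.assoc mult.left_commute)
  qed
  ultimately show ?case
    using assms(1)
    by (simp add: dmon_ins_Suc sum.distrib sum_distrib_left[symmetric] mult.assoc mult.left_commute)
qed simp

section \<open>Surjectivity of homogeneous differential polynomials\<close>

lemma surj_funpow_commutator: "surj (commutator v ^^ k)"
proof (induction k)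
  case (Suc k)
  show ?case using comp_surj[OF Suc surj_commutator] by simp
qed simp

text \<open>Homogeneity is carried along for the case of one variable, where it leaves a single
  monomial and hence an equation solvable by surjectivity of a power of the commutator.\<close>

lemma differential_polynomial_surj:
  assumes "finite V" and "V \<noteq> {}"
    and "\<forall>\<tau>\<in>permutations_of_set V. homogeneous V g d (P \<tau>)"
    and "\<exists>\<tau>\<in>permutations_of_set V. P \<tau> \<noteq> 0"
  shows "\<exists>x. (\<Sum>\<tau>\<in>permutations_of_set V. lin (dmon x \<tau>) (P \<tau>)) = y"
  using assms
proof (induction "card V" arbitrary: V g d P y rule: less_induct)
  case less
  obtain a where a: "a \<in> V" using less.prems(2) by blast
  define V' where "V' = V - {a}"
  have V: "V = insert a V'" "a \<notin> V'" "finite V'"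
    using a less.prems(1) by (auto simp: V'_def)
  show ?case
  proof (cases "V' = {}")
    case True
    with V have [simp]: "V = {a}" by simp
    have hom: "homogeneous {a} g d (P [a])" and nz: "P [a] \<noteq> 0"
      using less.prems(3,4) by simp_all
    from nz obtain \<alpha> where \<alpha>: "\<alpha> \<in> Poly_Mapping.keys (P [a])"
      by (metis keys_eq_empty ex_in_conv)
    have "\<beta> = \<alpha>" if "\<beta> \<in> Poly_Mapping.keys (P [a])" for \<beta>
    proof (rule poly_mapping_eqI)
      fix i
      show "Poly_Mapping.lookup \<beta> i = Poly_Mapping.lookup \<alpha> i"
        using hom that \<alpha> unfolding homogeneous_def by (cases "i = a") auto
    qed
    with \<alpha> have keys: "Poly_Mapping.keys (P [a]) = {\<alpha>}" by blast
    define c where "c = Poly_Mapping.lookup (P [a]) \<alpha>"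
    have "c \<noteq> 0" using \<alpha> by (simp add: c_def in_keys_iff)
    obtain z where z: "(commutator v ^^ Poly_Mapping.lookup \<alpha> a) z = scale (inverse c) y"
      using surj_funpow_commutator by (metis surjD)
    have "(\<Sum>\<tau>\<in>permutations_of_set V. lin (dmon (\<lambda>_. z) \<tau>) (P \<tau>)) = y"
      using \<open>c \<noteq> 0\<close> by (simp add: lin_def keys z c_def[symmetric])
    then show ?thesis by blast
  next
    case False
    let ?S = "permutations_of_set V" and ?S' = "permutations_of_set V'"
    \<comment> \<open>These are the parts of an ordering before and after \<open>a\<close>.\<close>
    define u where "u \<tau> = takeWhile (\<lambda>i. i \<noteq> a) \<tau>" for \<tau>
    define w where "w \<tau> = tl (dropWhile (\<lambda>i. i \<noteq> a) \<tau>)" for \<tau>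
    have split: "\<tau> = u \<tau> @ a # w \<tau>" if "\<tau> \<in> ?S" for \<tau>
    proof -
      have "a \<in> set \<tau>" using that a by (auto dest: permutations_of_setD)
      then have "dropWhile (\<lambda>i. i \<noteq> a) \<tau> \<noteq> []" "hd (dropWhile (\<lambda>i. i \<noteq> a) \<tau>) = a"
        using hd_dropWhile[of "\<lambda>i. i \<noteq> a" \<tau>] by (auto simp: dropWhile_eq_Nil_conv)
      then have "dropWhile (\<lambda>i. i \<noteq> a) \<tau> = a # w \<tau>"
        by (metis w_def list.collapse)
      then show ?thesis
        using takeWhile_dropWhile_id[of "\<lambda>i. i \<noteq> a" \<tau>] by (simp add: u_def)
    qed
    have perm: "distinct (u \<tau> @ a # w \<tau>)" "set (u \<tau> @ a # w \<tau>) = V" if "\<tau> \<in> ?S" for \<tau>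
      using permutations_of_setD[OF that] split[OF that] by simp_all
    have perm': "u \<tau> @ w \<tau> \<in> ?S'" if "\<tau> \<in> ?S" for \<tau>
      using perm[OF that] by (auto simp: V'_def intro!: permutations_of_setI)
    have a_notin: "a \<notin> set (u \<tau>)" "a \<notin> set (w \<tau>)" if "\<tau> \<in> ?S" for \<tau>
      using perm[OF that] by auto

    define m where "m = (LEAST m. \<exists>\<tau>\<in>?S. \<exists>\<alpha>\<in>Poly_Mapping.keys (P \<tau>). Poly_Mapping.lookup \<alpha> a = m)"
    have "\<exists>m. \<exists>\<tau>\<in>?S. \<exists>\<alpha>\<in>Poly_Mapping.keys (P \<tau>). Poly_Mapping.lookup \<alpha> a = m"
      using less.prems(4) by (metis keys_eq_empty ex_in_conv)
    then have m: "\<exists>\<tau>\<in>?S. \<exists>\<alpha>\<in>Poly_Mapping.keys (P \<tau>). Poly_Mapping.lookup \<alpha> a = m"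
      unfolding m_def by (rule LeastI_ex)
    have m_le: "m \<le> Poly_Mapping.lookup \<alpha> a" if "\<tau> \<in> ?S" "\<alpha> \<in> Poly_Mapping.keys (P \<tau>)" for \<tau> \<alpha>
      unfolding m_def by (rule Least_le) (use that in blast)

    \<comment> \<open>The power of the variable \<open>a\<close> stays in the coefficient;
      \<open>g(a := m)\<close> records it below.\<close>
    define P' where
      "P' \<tau> = Poly_Mapping.mapp (\<lambda>\<alpha> c. if Poly_Mapping.lookup \<alpha> a = m then c else 0) (P \<tau>)" for \<tau>
    have lookup_P': "Poly_Mapping.lookup (P' \<tau>) \<alpha> =
        (if Poly_Mapping.lookup \<alpha> a = m then Poly_Mapping.lookup (P \<tau>) \<alpha> else 0)" for \<tau> \<alpha>
      by (simp add: P'_def lookup_mapp when_def in_keys_iff)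
    \<comment> \<open>If \<open>P' \<tau>\<close> has a key, then \<open>m\<close> is a summand of
      \<open>d\<close>, so \<open>d - m\<close> is not truncated.\<close>
    have hom_P': "homogeneous V' (g(a := m)) (d - m) (P' \<tau>)" if "\<tau> \<in> ?S" for \<tau>
      unfolding homogeneous_def
    proof
      fix \<alpha> assume "\<alpha> \<in> Poly_Mapping.keys (P' \<tau>)"
      then have "\<alpha> \<in> Poly_Mapping.keys (P \<tau>)" and \<alpha>a: "Poly_Mapping.lookup \<alpha> a = m"
        by (auto simp: in_keys_iff lookup_P' split: if_splits)
      then have "(\<forall>i. i \<notin> V \<longrightarrow> Poly_Mapping.lookup \<alpha> i = g i)"
        and "(\<Sum>i\<in>V. Poly_Mapping.lookup \<alpha> i) = d"
        using less.prems(3) that by (auto simp: homogeneous_def)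
      then show "(\<forall>i. i \<notin> V' \<longrightarrow> Poly_Mapping.lookup \<alpha> i = (g(a := m)) i) \<and>
          (\<Sum>i\<in>V'. Poly_Mapping.lookup \<alpha> i) = d - m"
        using V \<alpha>a by auto
    qed

    \<comment> \<open>The orderings collected here differ only in the place of \<open>a\<close>;
      \<open>Q k \<tau>'\<close> is the part of their joint coefficient free of
      \<open>v\<close>.\<close>
    define Q where "Q k \<tau>' = (\<Sum>\<tau>\<in>{\<tau>\<in>?S. u \<tau> @ w \<tau> = \<tau>'}. slope (u \<tau>) ^ k * P' \<tau>)" for k \<tau>'
    have "\<exists>k. \<exists>\<tau>'\<in>?S'. Q k \<tau>' \<noteq> 0"
    proof (rule ccontr)
      assume "\<not> ?thesis"
      then have Q_zero: "Q k \<tau>' = 0" if "\<tau>' \<in> ?S'" for k \<tau>'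
        using that by blast
      obtain \<tau> \<alpha> where \<tau>: "\<tau> \<in> ?S" "\<alpha> \<in> Poly_Mapping.keys (P \<tau>)" "Poly_Mapping.lookup \<alpha> a = m"
        using m by blast
      define T where "T = {\<rho>\<in>?S. u \<rho> @ w \<rho> = u \<tau> @ w \<tau>}"
      \<comment> \<open>Both \<open>u \<rho>\<close> and \<open>u \<rho>'\<close> are prefixes of
        one list, so equal sets give equal lengths and thus equal prefixes.\<close>
      have "inj_on (\<lambda>\<rho>. slope (u \<rho>) :: 'f cpoly) T"
      proof (rule inj_onI)
        fix \<rho> \<rho>' assume \<rho>: "\<rho> \<in> T" "\<rho>' \<in> T" "(slope (u \<rho>) :: 'f cpoly) = slope (u \<rho>')"
        then have S: "\<rho> \<in> ?S" "\<rho>' \<in> ?S" and eq: "u \<rho> @ w \<rho> = u \<rho>' @ w \<rho>'"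
          by (auto simp: T_def)
        have "distinct (u \<rho>)" "distinct (u \<rho>')"
          using perm S by auto
        then have "length (u \<rho>) = length (u \<rho>')"
          using slope_eq_imp_set_eq[OF \<rho>(3)] by (metis distinct_card)
        then have "u \<rho> = u \<rho>'" "w \<rho> = w \<rho>'"
          using eq by auto
        then show "\<rho> = \<rho>'"
          using split S by metis
      qed
      moreover have "(\<Sum>\<rho>\<in>T. slope (u \<rho>) ^ k * P' \<rho>) = 0" for k
        using Q_zero[OF perm'[OF \<tau>(1)], of k] by (simp add: Q_def T_def)
      moreover have "finite T" "\<tau> \<in> T" using \<tau> by (auto simp: T_def)
      ultimately have "P' \<tau> = 0" 
        using vandermonde_independent[of T "\<lambda>\<rho>. slope (u \<rho>)" \<tau> P'] by blast
      then show False using \<tau> lookup_P'[of \<tau> \<alpha>] by (simp add: in_keys_iff)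
    qed
    \<comment> \<open>Minimality provides the vanishing sums that \<open>sum_dmon_ins\<close>
      requires.\<close>
    define k where "k = (LEAST k. \<exists>\<tau>'\<in>?S'. Q k \<tau>' \<noteq> 0)"
    have k: "\<exists>\<tau>'\<in>?S'. Q k \<tau>' \<noteq> 0"
      unfolding k_def by (rule LeastI_ex) fact
    have Q_less: "Q i \<tau>' = 0" if "i < k" "\<tau>' \<in> ?S'" for i \<tau>'
      using not_less_Least[OF that(1)[unfolded k_def]] that(2) by blast

    have "homogeneous V' (g(a := m)) (d - m + k) (Q k \<tau>')" for \<tau>'
      unfolding Q_def
    proof (rule homogeneous_sum)
      fix \<tau> assume "\<tau> \<in> {\<tau>\<in>?S. u \<tau> @ w \<tau> = \<tau>'}"
      then have "\<tau> \<in> ?S" by simp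
      then show "homogeneous V' (g(a := m)) (d - m + k) (slope (u \<tau>) ^ k * P' \<tau>)"
        using perm'[THEN permutations_of_setD(1)]
        by (intro homogeneous_slope_power_mult hom_P' V) auto
    qed
    moreover have "card V' < card V" using V by simp
    ultimately obtain x where x: "(\<Sum>\<tau>'\<in>?S'. lin (dmon x \<tau>') (Q k \<tau>')) = y"
      using less.hyps[of V' _ _ "Q k"] V(3) False k by blast

    \<comment> \<open>One \<open>z\<close> serves all orderings, as \<open>m\<close> is the least
      exponent over all of them; higher exponents differentiate \<open>v ^ k\<close> and give
      zero.\<close>
    obtain z where z: "(commutator v ^^ m) z = v ^ k"
      using surj_funpow_commutator by (metis surjD)
    have z_more: "(commutator v ^^ e) z = 0" if "m < e" for e
    proof -
      from that obtain e' where "e = e' + Suc 0 + m"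
        by (metis less_iff_Suc_add add.commute add_Suc_right add_0_right)
      then show ?thesis by (simp only: funpow_add o_apply z) simp
    qed
    have eval: "lin (dmon (x(a := z)) \<tau>) (P \<tau>) = dmon_ins x k (u \<tau>) (w \<tau>) (P' \<tau>)"
      if \<tau>: "\<tau> \<in> ?S" for \<tau>
    proof -
      have "scale (Poly_Mapping.lookup (P \<tau>) \<alpha>) (dmon (x(a := z)) \<tau> \<alpha>) =
          scale (Poly_Mapping.lookup (P' \<tau>) \<alpha>) (dmon x (u \<tau>) \<alpha> * v ^ k * dmon x (w \<tau>) \<alpha>)"
        if "\<alpha> \<in> Poly_Mapping.keys (P \<tau>)" for \<alpha>
      proof -
        have "dmon (x(a := z)) \<tau> \<alpha> = dmon x (u \<tau>) \<alpha> *
            (commutator v ^^ Poly_Mapping.lookup \<alpha> a) z * dmon x (w \<tau>) \<alpha>"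
          by (subst split[OF \<tau>]) (simp add: a_notin[OF \<tau>] mult.assoc)
        then show ?thesis
          using m_le[OF \<tau> that] z_more[of "Poly_Mapping.lookup \<alpha> a"]
          by (auto simp: lookup_P' z)
      qed
      moreover have "Poly_Mapping.keys (P' \<tau>) \<subseteq> Poly_Mapping.keys (P \<tau>)"
        unfolding P'_def by (rule keys_mapp_subset)
      ultimately show ?thesis
        by (simp add: dmon_ins_def lin_def[of "dmon _ _"] lin_superset[OF finite_keys])
    qed
    \<comment> \<open>With no \<open>v\<close> inserted, the two parts rejoin to an ordering of
      \<open>V'\<close>, so the sum can be grouped by it.\<close>
    have collect: "(\<Sum>\<tau>\<in>?S. dmon_ins x 0 (u \<tau>) (w \<tau>) (slope (u \<tau>) ^ i * P' \<tau>))
        = (\<Sum>\<tau>'\<in>?S'. lin (dmon x \<tau>') (Q i \<tau>'))" for i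
    proof -
      have "(\<Sum>\<tau>'\<in>?S'. lin (dmon x \<tau>') (Q i \<tau>'))
          = (\<Sum>\<tau>'\<in>?S'. \<Sum>\<tau>\<in>{\<tau>\<in>?S. u \<tau> @ w \<tau> = \<tau>'}.
              dmon_ins x 0 (u \<tau>) (w \<tau>) (slope (u \<tau>) ^ i * P' \<tau>))"
        unfolding Q_def lin_sum
        by (intro sum.cong refl) (auto simp: dmon_ins_def lin_def)
      also have "\<dots> = (\<Sum>\<tau>\<in>?S. dmon_ins x 0 (u \<tau>) (w \<tau>) (slope (u \<tau>) ^ i * P' \<tau>))"
        by (rule sum.group) (use perm' in auto)
      finally show ?thesis by simp
    qed
    have "(\<Sum>\<tau>\<in>?S. lin (dmon (x(a := z)) \<tau>) (P \<tau>))
        = (\<Sum>\<tau>\<in>?S. dmon_ins x k (u \<tau>) (w \<tau>) (P' \<tau>))"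
      by (intro sum.cong refl eval)
    also have "\<dots> = (\<Sum>\<tau>\<in>?S. dmon_ins x 0 (u \<tau>) (w \<tau>) (slope (u \<tau>) ^ k * P' \<tau>))"
      using perm by (intro sum_dmon_ins) (auto simp: collect Q_less)
    also have "\<dots> = y"
      by (simp add: collect x)
    finally show ?thesis by blast
  qed
qed

end

section \<open>Multilinear polynomials as the case without derivatives\<close>

lemma nc_const_mult_prod_list_nc_var:
  "nc_const c * prod_list (map nc_var is) = Poly_Mapping.single (Word is) c"
proof -
  have "prod_list (map nc_var is) = (Poly_Mapping.single (Word is) 1 :: 'a nc_poly)"
    by (induction "is")
      (simp_all add: nc_var_def mult_single plus_free_monoid_def flip: zero_free_monoid_def)
  then show ?thesis by (simp add: nc_const_def mult_single)
qed

lemma keys_multilinear: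
  assumes "multilinear n f"
  shows "Poly_Mapping.keys f \<subseteq> Word ` permutations_of_set {1..n}"
proof -
  obtain c where f: "f = (\<Sum>\<sigma> | \<sigma> permutes {1..n}.
      nc_const (c \<sigma>) * prod_list (map (\<lambda>i. nc_var (\<sigma> i)) [1..<Suc n]))"
    using assms by (auto simp: multilinear_def)
  also have "\<dots> = (\<Sum>\<sigma> | \<sigma> permutes {1..n}. Poly_Mapping.single (Word (map \<sigma> [1..<Suc n])) (c \<sigma>))"
    by (intro sum.cong refl)
      (simp only: nc_const_mult_prod_list_nc_var[symmetric] map_map o_def)
  finally have "Poly_Mapping.keys f \<subseteq> (\<Union>\<sigma>\<in>{\<sigma>. \<sigma> permutes {1..n}}.
      Poly_Mapping.keys (Poly_Mapping.single (Word (map \<sigma> [1..<Suc n])) (c \<sigma>)))"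
    using keys_sum by metis
  moreover have "map \<sigma> [1..<Suc n] \<in> permutations_of_set {1..n}" if "\<sigma> permutes {1..n}" for \<sigma>
  proof (rule permutations_of_setI)
    show "set (map \<sigma> [1..<Suc n]) = {1..n}"
      using permutes_image[OF that] by (simp add: atLeastLessThanSuc_atLeastAtMost del: upt_Suc)
    show "distinct (map \<sigma> [1..<Suc n])"
      using permutes_inj_on[OF that] by (simp add: distinct_map del: upt_Suc)
  qed
  ultimately show ?thesis by (auto split: if_splits simp del: upt_Suc)
qed

theorem theorem1p2:
  fixes scale :: "'f::field \<Rightarrow> 'a::{ring, monoid_mult} \<Rightarrow> 'a"
    and d :: "'a \<Rightarrow> 'a"
    and n :: nat
    and f :: "'f nc_poly"
  assumes "unital_algebra scale"
    and "inner_derivation d"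
    and "surj d"
    and "n \<ge> 1"
    and "f \<in> free_algebra n"
    and "multilinear n f"
    and "f \<noteq> 0"
  shows "nc_image scale f = UNIV"
proof -
  obtain v where "d = commutator v"
    using assms(2) by (auto simp: inner_derivation_def fun_eq_iff)
  with assms(1,3) interpret surjective_commutator scale v
    by (auto simp: surjective_commutator_def surjective_commutator_axioms_def)
  let ?S = "permutations_of_set {1..n}"
  \<comment> \<open>Exponent \<open>0\<close> means that nothing is differentiated, so all
    coefficients are homogeneous of degree \<open>0\<close>.\<close>
  define P :: "nat list \<Rightarrow> 'f cpoly"
    where "P \<tau> = Poly_Mapping.single 0 (Poly_Mapping.lookup f (Word \<tau>))" for \<tau>
  note keys = keys_multilinear[OF assms(6)]
  have eval: "nc_eval scale f x = (\<Sum>\<tau>\<in>?S. lin (dmon x \<tau>) (P \<tau>))" for x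
  proof -
    have "nc_eval scale f x = (\<Sum>w\<in>Word ` ?S.
        scale (Poly_Mapping.lookup f w) (prod_list (map x (letters w))))"
      unfolding nc_eval_def
      by (rule sum.mono_neutral_left) (use keys in \<open>auto simp: in_keys_iff\<close>)
    also have "\<dots> = (\<Sum>\<tau>\<in>?S. lin (dmon x \<tau>) (P \<tau>))"
      by (subst sum.reindex) (auto simp: inj_on_def P_def dmon_def)
    finally show ?thesis .
  qed
  have "\<forall>\<tau>\<in>?S. homogeneous {1..n} (\<lambda>_. 0) 0 (P \<tau>)"
    by (simp add: P_def homogeneous_def)
  moreover have "\<exists>\<tau>\<in>?S. P \<tau> \<noteq> 0"
  proof -
    from assms(7) obtain w where w: "w \<in> Poly_Mapping.keys f"
      by (metis keys_eq_empty ex_in_conv)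
    with keys obtain \<tau> where "w = Word \<tau>" "\<tau> \<in> ?S" by blast
    moreover from this w have "Poly_Mapping.lookup (P \<tau>) 0 \<noteq> 0"
      by (simp add: P_def in_keys_iff)
    ultimately show ?thesis by (metis lookup_zero)
  qed
  ultimately have "\<exists>x. nc_eval scale f x = y" for y
    unfolding eval using assms(4) by (intro differential_polynomial_surj) auto
  then show ?thesis by (auto simp: nc_image_def) metis
qed

end
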